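(* Let $d\ge1$, $f$ a monic hyperbolic polynomial of degree $d$, $0\le s\le d$, and $u$ a composition of $d$. If $H_s^u(f)$ contains a polynomial whose composition is exactly $u$, then $\dim H_s^u(f)=\max\{\ell(u)-s,0\}$ and the relative interior of $H_s^u(f)$ is exactly the set of polynomials $h\in H_s^u(f)$ with $v(h)=u$.
   Context: Hyperbolic: all roots real. $f=t^d+f_1t^{d-1}+\dots+f_d$; $H_s(f)$ is the set of monic hyperbolic degree-$d$ polynomials $h=t^d+h_1t^{d-1}+\dots+h_d$ with $h_i=f_i$ for $1\le i\le s$, identified with $(h_{s+1},\dots,h_d)\in\mathbb{R}^{d-s}$ with the Euclidean subspace topology. Compositions of $d$: tuples of positive integers summing to $d$, length $\ell(u)$; $v\le u$ iff $v$ arises from $u$ by merging consecutive parts. $v(h)$ is the tuple of multiplicities of the distinct roots of $h$ in increasing order; $H_s^u(f)=\{h\in H_s(f):v(h)\le u\}$. Dimension is the dimension of a semialgebraic set. For a nonempty stratum of dimension $n$, its relative interior is the set of $h$ in it having an open neighbourhood (in the stratum) homeomorphic to an open subset of $\mathbb{R}^n$; its relative boundary is the complement of the relative interior in the stratum. *)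

theory Defs
  imports "HOL-Analysis.Analysis" "HOL-Computational_Algebra.Polynomial"
begin

definition hyperbolic :: "real poly \<Rightarrow> bool" where
  "hyperbolic p \<longleftrightarrow> p \<noteq> 0 \<and>
     (\<forall>z::complex. poly (map_poly complex_of_real p) z = 0 \<longrightarrow> z \<in> \<real>)"

text \<open>For monic h of degree d, h = t^d + h_1 t^(d-1) + ... + h_d, so h_i = coeff h (d - i).\<close>
definition hcoef :: "nat \<Rightarrow> real poly \<Rightarrow> nat \<Rightarrow> real" where
  "hcoef d h i = coeff h (d - i)"

definition composition :: "nat \<Rightarrow> nat list \<Rightarrow> bool" where
  "composition d u \<longleftrightarrow> (\<forall>x\<in>set u. 0 < x) \<and> sum_list u = d"

definition comp_le :: "nat list \<Rightarrow> nat list \<Rightarrow> bool" where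
  "comp_le v u \<longleftrightarrow> (\<exists>gs. u = concat gs \<and> (\<forall>g\<in>set gs. g \<noteq> []) \<and> v = map sum_list gs)"

definition mult_comp :: "real poly \<Rightarrow> nat list" where
  "mult_comp h = map (\<lambda>x. order x h) (sorted_list_of_set {x. poly h x = 0})"

definition Hs :: "nat \<Rightarrow> nat \<Rightarrow> real poly \<Rightarrow> real poly set" where
  "Hs d s f = {h. degree h = d \<and> lead_coeff h = 1 \<and> hyperbolic h \<and>
                  (\<forall>i. 1 \<le> i \<and> i \<le> s \<longrightarrow> hcoef d h i = hcoef d f i)}"

definition Hsu :: "nat \<Rightarrow> nat \<Rightarrow> real poly \<Rightarrow> nat list \<Rightarrow> real poly set" where
  "Hsu d s f u = {h \<in> Hs d s f. comp_le (mult_comp h) u}"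

text \<open>Identification of h with (h_{s+1},...,h_d) in R^(d-s), realised as a point of
  the carrier of Euclidean_space (d - s): coordinate i (i < d-s) is h_{s+1+i}.\<close>
definition coords :: "nat \<Rightarrow> nat \<Rightarrow> real poly \<Rightarrow> nat \<Rightarrow> real" where
  "coords d s h = (\<lambda>i. if i < d - s then hcoef d h (s + 1 + i) else 0)"

definition has_open_cell :: "'a topology \<Rightarrow> 'a set \<Rightarrow> nat \<Rightarrow> bool" where
  "has_open_cell X S n \<longleftrightarrow> (\<exists>U W. U \<subseteq> S \<and> U \<noteq> {} \<and> openin (Euclidean_space n) W \<and>
       subtopology X U homeomorphic_space subtopology (Euclidean_space n) W)"

definition sa_dim :: "'a topology \<Rightarrow> 'a set \<Rightarrow> nat" where
  "sa_dim X S = (GREATEST n. has_open_cell X S n)"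

definition rel_int_dim :: "'a topology \<Rightarrow> 'a set \<Rightarrow> 'a set" where
  "rel_int_dim X S = {x \<in> S. \<exists>N W. openin (subtopology X S) N \<and> x \<in> N \<and>
       openin (Euclidean_space (sa_dim X S)) W \<and>
       subtopology X N homeomorphic_space subtopology (Euclidean_space (sa_dim X S)) W}"

end

theory Submission
  imports "HOL-Homology.Invariance_of_Domain"
    "HOL-Computational_Algebra.Formal_Power_Series"
    "HOL-Computational_Algebra.Fundamental_Theorem_Algebra" Defs
begin

text \<open>
  Write the elements of the stratum as products of (t - x i)^(u i) with x weakly increasing, and let
  l be the length of u. If x and y are increasing and differ, there is a polynomial q of degree below
  l with the sign of y i - x i between x i and y i for all i, since at most l - 1 sign changes are
  needed. Integrating q from x i to y i and summing with the weights u i shows that the weighted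
  power sums of x and y of exponents 1, ..., l cannot all agree; by Newton's identities the first l
  coefficients determine the point. Hence forgetting all coefficients beyond the l-th one embeds the
  stratum injectively into Euclidean space of dimension l - s, and invariance of domain turns the
  dimension and the relative interior of the stratum into those of its image.

  Points with distinct x i are interior, again by invariance of domain, now for the open chamber
  of strictly increasing x. If x k = x (k + 1), look at the points with the same first l - 1
  coefficients: for them the signs of y i - x i must alternate strictly, and the double root leaves
  only one of the two alternating patterns. So the l-th coefficient can move away from that of x
  in one direction only, and x is not interior.
\<close>

subsection \<open>Weighted power sums of increasing sequences\<close>

lemma mult_pos_flip:
  fixes a b p :: real
  assumes "a * b < 0" "p * a > 0"
  shows "p * b < 0"
  using assms by (auto simp: zero_less_mult_iff mult_less_0_iff)

text \<open>The third conjunct says that \<open>q\<close> has the full degree n - 1 only if the signs of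
  y i - x i strictly alternate; the last one, that \<open>q\<close> does not change sign any more
  after the last nontrivial interval, is what makes the induction on n work.\<close>

definition sign_matching :: "nat \<Rightarrow> (nat \<Rightarrow> real) \<Rightarrow> (nat \<Rightarrow> real) \<Rightarrow> real poly \<Rightarrow> bool" where
  "sign_matching n x y q \<longleftrightarrow> (\<forall>k\<ge>n. coeff q k = 0) \<and>
    (\<forall>i<n. \<forall>t. min (x i) (y i) < t \<and> t < max (x i) (y i) \<longrightarrow> poly q t * (y i - x i) > 0) \<and>
    (coeff q (n - 1) = 0 \<or> (\<forall>i<n. (-1) ^ (n - 1 - i) * coeff q (n - 1) * (y i - x i) > 0)) \<and>
    (\<forall>j<n. x j \<noteq> y j \<and> (\<forall>i<n. j < i \<longrightarrow> x i = y i) \<longrightarrow>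
       (\<forall>t>min (x j) (y j). poly q t * (y j - x j) > 0))"

text \<open>Induction on \<open>n\<close>. If the sign of the new interval agrees with that of the
  last nontrivial one before it, the old polynomial still works; otherwise one linear factor
  vanishing between the two is added. So the degree grows only with sign changes.\<close>

lemma sign_matching_exists:
  fixes x y :: "nat \<Rightarrow> real"
  assumes "mono_on {..<n} x" "mono_on {..<n} y"
  shows "\<exists>q. sign_matching n x y q"
  using assms
proof (induction n)
  case 0
  show ?case by (intro exI[of _ 0]) (simp add: sign_matching_def)
next
  case (Suc n)
  have "mono_on {..<n} x" "mono_on {..<n} y"
    using Suc.prems by (auto intro: mono_on_subset)
  from Suc.IH[OF this] obtain q where q: "sign_matching n x y q" ..
  have deg: "coeff q k = 0" if "k \<ge> n" for k
    using q that by (simp add: sign_matching_def)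
  have sgn: "poly q t * (y i - x i) > 0"
    if "i < n" "min (x i) (y i) < t" "t < max (x i) (y i)" for i t
    using q that unfolding sign_matching_def by blast
  have alt: "coeff q (n - 1) = 0 \<or> (\<forall>i<n. (-1) ^ (n - 1 - i) * coeff q (n - 1) * (y i - x i) > 0)"
    using q unfolding sign_matching_def by blast
  have tail: "poly q t * (y j - x j) > 0"
    if "j < n" "x j \<noteq> y j" "\<And>i. i < n \<Longrightarrow> j < i \<Longrightarrow> x i = y i" "t > min (x j) (y j)" for j t
    using q that unfolding sign_matching_def by blast
  have le_n: "x i \<le> x n" "y i \<le> y n" if "i < n" for i
    using Suc.prems that by (auto simp: mono_on_def)
  show ?case
  proof (cases "x n = y n")
    case True
    show ?thesis
    proof (intro exI[of _ q], unfold sign_matching_def, intro conjI allI impI)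
      fix i t assume *: "i < Suc n" "min (x i) (y i) < t \<and> t < max (x i) (y i)"
      with True have "i < n" by (cases "i = n") auto
      with * sgn show "poly q t * (y i - x i) > 0" by blast
    next
      fix j t
      assume *: "j < Suc n" "x j \<noteq> y j \<and> (\<forall>i<Suc n. j < i \<longrightarrow> x i = y i)" "min (x j) (y j) < t"
      with True have "j < n" by (cases "j = n") auto
      with * tail show "poly q t * (y j - x j) > 0" by auto
    qed (use deg in auto)
  next
    case neq: False
    show ?thesis
    proof (cases "\<exists>j<n. x j \<noteq> y j")
      case False
      \<comment> \<open>All earlier intervals are degenerate, so a constant suffices. Only for
        \<open>n = 0\<close> is it itself the coefficient in the alternation clause, which then says
        that a nonzero square is positive.\<close>
      have "coeff [:y n - x n:] n = 0 \<or> n = 0"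
        by (cases n) auto
      then show ?thesis
        using False neq
        by (intro exI[of _ "[:y n - x n:]"])
           (auto simp: sign_matching_def less_Suc_eq coeff_pCons split: nat.splits simp flip: power2_eq_square)
    next
      case True
      \<comment> \<open>\<open>j\<close> is the last nontrivial interval before \<open>n\<close>; to
        the right of its left end \<open>q\<close> has constant sign.\<close>
      define j where "j = (GREATEST j. j < n \<and> x j \<noteq> y j)"
      have j: "j < n \<and> x j \<noteq> y j"
        unfolding j_def by (rule GreatestI_ex_nat[where b = n]) (use True in auto)
      have jmax: "x i = y i" if "j < i" "i < n" for i
        using Greatest_le_nat[of "\<lambda>j. j < n \<and> x j \<noteq> y j" i n] that unfolding j_def by force
      have qtail: "poly q t * (y j - x j) > 0" if "t > min (x j) (y j)" for t
        using tail[of j t] j jmax that by auto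
      show ?thesis
      proof (cases "(y j - x j) * (y n - x n) > 0")
        \<comment> \<open>The sign needed at \<open>n\<close> is the one that \<open>q\<close> keeps
          beyond interval \<open>j\<close>. The coefficient of \<open>q\<close> at \<open>n\<close>
          is 0, which settles the alternation clause.\<close>
        case same: True
        have pos: "poly q t * (y n - x n) > 0" if "t > min (x n) (y n)" for t
        proof -
          have "t > min (x j) (y j)" using le_n[of j] j that by (auto simp: min_def split: if_splits)
          from qtail[OF this] same show ?thesis
            by (smt (verit, best) zero_less_mult_iff)
        qed
        show ?thesis
        proof (intro exI[of _ q], unfold sign_matching_def, intro conjI allI impI)
          fix i t assume *: "i < Suc n" "min (x i) (y i) < t \<and> t < max (x i) (y i)"
          then show "poly q t * (y i - x i) > 0" using pos sgn by (cases "i = n") auto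
        next
          fix j' t
          assume *: "j' < Suc n" "x j' \<noteq> y j' \<and> (\<forall>i<Suc n. j' < i \<longrightarrow> x i = y i)" "min (x j') (y j') < t"
          with neq have "j' = n" by (metis less_Suc_eq lessI)
          with * pos show "poly q t * (y j' - x j') > 0" by auto
        qed (use deg in auto)
      next
        case False
        with j neq have opp: "(y j - x j) * (y n - x n) < 0"
          by (auto simp: not_less order.order_iff_strict)
        \<comment> \<open>Opposite displacements at \<open>j\<close> and \<open>n\<close> and
          monotonicity force interval \<open>j\<close>, and every earlier nontrivial one, to end at
          or before \<open>z\<close>, where interval \<open>n\<close> begins.\<close>
        define z where "z = min (x n) (y n)"
        have zj: "max (x j) (y j) \<le> z"
          using opp le_n[of j] j by (auto simp: z_def mult_less_0_iff)
        have zi: "max (x i) (y i) \<le> z" if "i < n" "x i \<noteq> y i" for i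
        proof -
          have "i \<le> j" using jmax that by (meson not_le)
          then have "x i \<le> x j" "y i \<le> y j" using Suc.prems j by (auto simp: mono_on_def)
          with zj show ?thesis by auto
        qed
        \<comment> \<open>The factor \<open>z - t\<close> is positive on the earlier nontrivial
          intervals and negative on the new one.\<close>
        define q' where "q' = q * [:z, -1:]"
        have pq': "poly q' t = poly q t * (z - t)" for t by (simp add: q'_def algebra_simps)
        have pos: "poly q' t * (y n - x n) > 0" if "t > z" for t
        proof -
          have "poly q t * (y j - x j) > 0" using qtail[of t] zj that j by auto
          from mult_pos_flip[OF opp this] have "(z - t) * (poly q t * (y n - x n)) > 0"
            using that by (intro mult_neg_neg) auto
          then show ?thesis unfolding pq' by (simp add: mult_ac)
        qed
        have cf: "coeff q' (Suc k) = z * coeff q (Suc k) - coeff q k" for k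
          by (simp add: q'_def)
        \<comment> \<open>The new coefficient at \<open>n\<close> is minus that of \<open>q\<close>
          at \<open>n - 1\<close>. If it is nonzero, the signs up to \<open>n - 1\<close> already
          alternate, so interval \<open>n - 1\<close> is nontrivial and equals interval
          \<open>j\<close>; the opposite sign at \<open>n\<close> continues the pattern.\<close>
        have alt': "coeff q' n = 0 \<or> (\<forall>i<Suc n. (-1) ^ (n - i) * coeff q' n * (y i - x i) > 0)"
        proof (cases "coeff q' n = 0")
          case nz: False
          obtain m where m: "n = Suc m" using j by (cases n) auto
          have cn: "coeff q' n = - coeff q m" using cf[of m] deg[of "Suc m"] m by simp
          have alt2: "(-1) ^ (m - i) * coeff q m * (y i - x i) > 0" if "i < n" for i
          proof -
            have "coeff q m \<noteq> 0" using nz cn by simp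
            with alt that m show ?thesis by simp
          qed
          have "x m \<noteq> y m" using alt2[of m] m by auto
          then have "m = j" using jmax[of m] j m by (metis lessI less_Suc_eq)
          have "(-1) ^ (n - i) * coeff q' n * (y i - x i) > 0" if "i < Suc n" for i
          proof (cases "i = n")
            case True
            have "coeff q m * (y j - x j) > 0" using alt2[of m] m \<open>m = j\<close> by simp
            from mult_pos_flip[OF opp this] True cn show ?thesis by simp
          next
            case False
            then have "i < n" using that by simp
            then have "n - i = Suc (m - i)" using m by simp
            with alt2[OF \<open>i < n\<close>] cn show ?thesis by simp
          qed
          then show ?thesis by blast
        qed auto
        show ?thesis
        proof (intro exI[of _ q'], unfold sign_matching_def, intro conjI allI impI)
          fix k assume "Suc n \<le> k"
          then obtain k' where "k = Suc k'" "n \<le> k'" by (cases k) auto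
          then show "coeff q' k = 0" using cf deg by simp
        next
          fix i t assume *: "i < Suc n" "min (x i) (y i) < t \<and> t < max (x i) (y i)"
          show "poly q' t * (y i - x i) > 0"
          proof (cases "i = n")
            case True
            then show ?thesis using pos * by (simp add: z_def)
          next
            case False
            then have "i < n" using * by simp
            have "x i \<noteq> y i" using * by auto
            then have "t < z" using zi[OF \<open>i < n\<close>] * by linarith
            moreover have "poly q t * (y i - x i) > 0" using sgn[OF \<open>i < n\<close>] * by blast
            ultimately have "(poly q t * (y i - x i)) * (z - t) > 0" by simp
            then show ?thesis unfolding pq' by (simp add: mult_ac)
          qed
        next
          fix j' t
          assume *: "j' < Suc n" "x j' \<noteq> y j' \<and> (\<forall>i<Suc n. j' < i \<longrightarrow> x i = y i)" "min (x j') (y j') < t"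
          with neq have "j' = n" by (metis less_Suc_eq lessI)
          with * pos show "poly q' t * (y j' - x j') > 0" by (auto simp: z_def)
        qed (use alt' in auto)
      qed
    qed
  qed
qed

section \<open>Comparing the moments of two increasing sequences\<close>

definition wmoment :: "nat \<Rightarrow> (nat \<Rightarrow> nat) \<Rightarrow> (nat \<Rightarrow> real) \<Rightarrow> nat \<Rightarrow> real" where
  "wmoment n w x k = (\<Sum>i<n. real (w i) * x i ^ k)"

text \<open>The \<open>c k\<close> are the coefficients of an antiderivative of a sign-matching
  polynomial. By the mean value theorem its value at \<open>y i\<close> exceeds that at
  \<open>x i\<close> whenever the two points differ, in whichever order they lie, and the positive
  weights preserve this.\<close>

lemma separating_combination:
  fixes x y :: "nat \<Rightarrow> real"
  assumes mono: "mono_on {..<n} x" "mono_on {..<n} y"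
    and w: "\<And>i. i < n \<Longrightarrow> w i > 0" and neq: "\<exists>i<n. x i \<noteq> y i"
  obtains c :: "nat \<Rightarrow> real" where
    "(\<Sum>k<n. c k * (wmoment n w y (Suc k) - wmoment n w x (Suc k))) > 0"
    "c (n - 1) = 0 \<or> (\<forall>i<n. (-1) ^ (n - 1 - i) * c (n - 1) * (y i - x i) > 0)"
proof -
  obtain q where q: "sign_matching n x y q" using sign_matching_exists[OF mono] ..
  have deg: "coeff q k = 0" if "k \<ge> n" for k
    using q that by (simp add: sign_matching_def)
  have sgn: "poly q t * (y i - x i) > 0"
    if "i < n" "min (x i) (y i) < t" "t < max (x i) (y i)" for i t
    using q that unfolding sign_matching_def by blast
  have alt: "coeff q (n - 1) = 0 \<or> (\<forall>i<n. (-1) ^ (n - 1 - i) * coeff q (n - 1) * (y i - x i) > 0)"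
    using q unfolding sign_matching_def by blast
  define c where "c k = coeff q k / real (Suc k)" for k
  define P where "P = (\<Sum>k<n. monom (c k) (Suc k))"
  have pd: "pderiv P = q"
    by (rule poly_eqI)
       (use deg in \<open>auto simp: P_def c_def coeff_pderiv coeff_sum not_less simp del: of_nat_Suc\<close>)
  have pP: "poly P t = (\<Sum>k<n. c k * t ^ Suc k)" for t
    by (simp add: P_def poly_sum poly_monom)
  have incr: "poly P (y i) - poly P (x i) > 0" if "i < n" "x i \<noteq> y i" for i
  proof (cases "x i < y i")
    case True
    from poly_MVT[OF True, of P] obtain t where
      "x i < t" "t < y i" "poly P (y i) - poly P (x i) = (y i - x i) * poly q t"
      using pd by auto
    then show ?thesis using sgn[OF \<open>i < n\<close>, of t] by (simp add: mult.commute)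
  next
    case False
    then have "y i < x i" using that by simp
    from poly_MVT[OF this, of P] obtain t where
      "y i < t" "t < x i" "poly P (x i) - poly P (y i) = (x i - y i) * poly q t"
      using pd by auto
    then show ?thesis using sgn[OF \<open>i < n\<close>, of t] by (simp add: algebra_simps)
  qed
  have "(\<Sum>i<n. real (w i) * (poly P (y i) - poly P (x i))) > 0"
  proof -
    obtain i where i: "i < n" "x i \<noteq> y i" using neq by blast
    show ?thesis
    proof (rule sum_pos2[of _ i])
      fix j assume "j \<in> {..<n}"
      then show "0 \<le> real (w j) * (poly P (y j) - poly P (x j))"
        using incr[of j] by (cases "x j = y j") auto
    qed (use i incr[of i] w in auto)
  qed
  also have "(\<Sum>i<n. real (w i) * (poly P (y i) - poly P (x i))) =
      (\<Sum>k<n. c k * (wmoment n w y (Suc k) - wmoment n w x (Suc k)))"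
  proof -
    have "(\<Sum>i<n. real (w i) * (poly P (y i) - poly P (x i))) =
        (\<Sum>i<n. \<Sum>k<n. c k * (real (w i) * y i ^ Suc k - real (w i) * x i ^ Suc k))"
      by (intro sum.cong refl)
         (simp only: pP sum_distrib_left sum_subtractf[symmetric], simp only: algebra_simps)
    also have "\<dots> = (\<Sum>k<n. \<Sum>i<n. c k * (real (w i) * y i ^ Suc k - real (w i) * x i ^ Suc k))"
      by (rule sum.swap)
    also have "\<dots> = (\<Sum>k<n. c k * (wmoment n w y (Suc k) - wmoment n w x (Suc k)))"
      by (simp only: wmoment_def sum_distrib_left sum_subtractf[symmetric])
    finally show ?thesis .
  qed
  finally have "(\<Sum>k<n. c k * (wmoment n w y (Suc k) - wmoment n w x (Suc k))) > 0" .
  moreover have "c (n - 1) = 0 \<or> (\<forall>i<n. (-1) ^ (n - 1 - i) * c (n - 1) * (y i - x i) > 0)"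
    using alt by (auto simp: c_def zero_less_divide_iff)
  ultimately show ?thesis by (rule that)
qed

lemma wmoment_injective:
  assumes "mono_on {..<n} x" "mono_on {..<n} y" "\<And>i. i < n \<Longrightarrow> w i > 0"
    and "\<And>k. 1 \<le> k \<Longrightarrow> k \<le> n \<Longrightarrow> wmoment n w x k = wmoment n w y k"
    and "i < n"
  shows "x i = y i"
proof (rule ccontr)
  assume "x i \<noteq> y i"
  with \<open>i < n\<close> have "\<exists>i<n. x i \<noteq> y i" by blast
  from separating_combination[OF assms(1-3) this] obtain c :: "nat \<Rightarrow> real" where
    "(\<Sum>k<n. c k * (wmoment n w y (Suc k) - wmoment n w x (Suc k))) > 0" .
  with assms(4) show False by simp
qed

text \<open>At a double point x k = x (k + 1) the displacements y k - x k and y (k + 1) - x (k + 1)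
  cannot have signs +, -, so only one of the two alternating sign patterns remains.\<close>

lemma wmoment_extremal:
  assumes mono: "mono_on {..<n} x" "mono_on {..<n} y" and w: "\<And>i. i < n \<Longrightarrow> w i > 0"
    and eq: "\<And>j. 1 \<le> j \<Longrightarrow> j < n \<Longrightarrow> wmoment n w x j = wmoment n w y j"
    and k: "Suc k < n" "x k = x (Suc k)"
  shows "(-1) ^ (n - k) * (wmoment n w y n - wmoment n w x n) \<ge> 0"
proof (cases "\<exists>i<n. x i \<noteq> y i")
  case True
  obtain m where m: "n = Suc m" using k by (cases n) auto
  obtain c :: "nat \<Rightarrow> real" where
    c: "(\<Sum>k<n. c k * (wmoment n w y (Suc k) - wmoment n w x (Suc k))) > 0"
    and alt: "c (n - 1) = 0 \<or> (\<forall>i<n. (-1) ^ (n - 1 - i) * c (n - 1) * (y i - x i) > 0)"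
    using separating_combination[OF mono w True] .
  define D where "D = wmoment n w y n - wmoment n w x n"
  \<comment> \<open>Equality of the lower moments leaves only the top term, so \<open>c m\<close>
    and \<open>D\<close> are nonzero of the same sign. This also excludes the first alternative in
    \<open>alt\<close>.\<close>
  have "(\<Sum>k<m. c k * (wmoment n w y (Suc k) - wmoment n w x (Suc k))) = 0"
    by (rule sum.neutral) (use eq m in auto)
  with c have cD: "c m * D > 0" by (simp add: m D_def)
  then have "c m \<noteq> 0" by auto
  with alt have alt': "(-1) ^ (m - i) * c m * (y i - x i) > 0" if "i < n" for i
    using that by (simp add: m)
  define e where "e = (-1) ^ (m - k) * c m"
  have "m - k = Suc (m - Suc k)" using k m by simp
  with alt'[of k] alt'[of "Suc k"] k have
    "e * (y k - x k) > 0" "- e * (y (Suc k) - x (Suc k)) > 0" by (auto simp: e_def)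
  \<comment> \<open>A positive \<open>e\<close> would make the displacement at \<open>k\<close>
    positive and the weakly larger one at \<open>Suc k\<close> negative.\<close>
  moreover have "y k - x k \<le> y (Suc k) - x (Suc k)"
    using k mono(2) by (simp add: mono_on_def)
  ultimately have "e < 0"
    by (auto simp: zero_less_mult_iff mult_less_0_iff)
  moreover have "(-1) ^ (n - k) = - ((-1 :: real) ^ (m - k))" using k m by (simp add: Suc_diff_le)
  ultimately have "((-1) ^ (n - k) * c m) > 0" by (simp add: e_def)
  with cD have "((-1) ^ (n - k) * c m) * (c m * D) > 0" by simp
  then have "((-1) ^ (n - k) * D) * (c m)\<^sup>2 > 0" by (simp add: power2_eq_square mult_ac)
  then have "(-1) ^ (n - k) * D > 0"
    by (rule zero_less_mult_pos2) (use \<open>c m \<noteq> 0\<close> in simp)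
  then show ?thesis unfolding D_def by simp
next
  case False
  then show ?thesis by (simp add: wmoment_def)
qed

subsection \<open>Polynomials with prescribed root multiplicities\<close>

text \<open>Entries of \<open>x\<close> may coincide: equal neighbours merge the corresponding parts
  of \<open>u\<close>, so weakly increasing \<open>x\<close> reach the whole stratum.\<close>

definition root_prod :: "nat list \<Rightarrow> (nat \<Rightarrow> real) \<Rightarrow> real poly" where
  "root_prod u x = (\<Prod>i<length u. [:- x i, 1:] ^ (u ! i))"

lemma root_prod_nonzero [simp]: "root_prod u x \<noteq> 0"
  by (simp add: root_prod_def)

lemma degree_root_prod [simp]: "degree (root_prod u x) = sum_list u"
  by (simp add: root_prod_def degree_prod_eq_sum_degree degree_power_eq sum_list_sum_nth
      atLeast0LessThan)

lemma lead_coeff_root_prod [simp]: "lead_coeff (root_prod u x) = 1"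
  by (simp add: root_prod_def lead_coeff_prod lead_coeff_power del: degree_root_prod)

lemma root_prod_roots:
  assumes "\<And>i. i < length u \<Longrightarrow> u ! i > 0"
  shows "{t. poly (root_prod u x) t = 0} = x ` {..<length u}"
  using assms by (force simp: root_prod_def poly_prod)

lemma hyperbolic_root_prod: "hyperbolic (root_prod u x)"
proof -
  let ?c = "map_poly complex_of_real"
  have mult: "?c (p * q) = ?c p * ?c q" for p q
    by (rule poly_eqI) (simp add: coeff_map_poly coeff_mult)
  have pow: "?c (p ^ n) = ?c p ^ n" for p n
    by (induction n) (simp_all add: mult)
  have "?c (\<Prod>i<n. [:- x i, 1:] ^ (u ! i)) = (\<Prod>i<n. [:- of_real (x i), 1:] ^ (u ! i))" for n
    by (induction n) (simp_all add: mult pow map_poly_pCons)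
  then have "poly (?c (root_prod u x)) z = (\<Prod>i<length u. (z - of_real (x i)) ^ (u ! i))" for z
    by (simp add: root_prod_def poly_prod)
  then show ?thesis by (auto simp: hyperbolic_def)
qed

text \<open>The product is the reversal of \<open>root_prod u x\<close>, so this is the coefficient written
  \<open>h\<^sub>k\<close> in the paper, but defined for all k.\<close>

definition monic_coeff :: "nat list \<Rightarrow> (nat \<Rightarrow> real) \<Rightarrow> nat \<Rightarrow> real" where
  "monic_coeff u x k = coeff (\<Prod>i<length u. [:1, - x i:] ^ (u ! i)) k"

section \<open>Coefficients and Newton's identities\<close>

lemma hcoef_root_prod:
  assumes "k \<le> sum_list u"
  shows "hcoef (sum_list u) (root_prod u x) k = monic_coeff u x k"
proof -
  have "reflect_poly [:- a, 1:] = [:1, - a:]" for a :: real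
    by (simp add: reflect_poly_pCons' monom_Suc monom_0)
  then have "reflect_poly (root_prod u x) = (\<Prod>i<length u. [:1, - x i:] ^ (u ! i))"
    by (simp add: root_prod_def reflect_poly_prod reflect_poly_power)
  then show ?thesis
    using assms by (metis monic_coeff_def hcoef_def coeff_reflect_poly degree_root_prod not_less)
qed

text \<open>Logarithmic differentiation of the reversed polynomial \<open>R\<close>: as power
  series, \<open>R' = - R * S\<close>, where \<open>S\<close> generates the weighted power sums.
  Comparing coefficients gives the identity.\<close>

lemma newton_identity:
  "real (Suc k) * monic_coeff u x (Suc k) =
    - (\<Sum>j\<le>k. monic_coeff u x j * wmoment (length u) (\<lambda>i. u ! i) x (Suc (k - j)))"
proof -
  \<comment> \<open>The geometric series is the inverse of \<open>1 - a X\<close>, so logarithmic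
    derivatives can be written without division.\<close>
  define G where "G a = Abs_fps (\<lambda>k. a ^ k)" for a :: real
  have G: "(1 - fps_const a * fps_X) * G a = 1" for a
    by (rule fps_ext) (auto simp: G_def algebra_simps gr0_conv_Suc)
  define R where "R n = (\<Prod>i<n. (1 - fps_const (x i) * fps_X) ^ (u ! i))" for n
  define S where "S n = (\<Sum>i<n. fps_const (real (u ! i) * x i) * G (x i))" for n
  have pow: "fps_deriv ((1 - fps_const a * fps_X) ^ m) =
      - ((1 - fps_const a * fps_X) ^ m * (fps_const (real m * a) * G a))" for a :: real and m
  proof (cases m)
    case (Suc m')
    define E where "E = 1 - fps_const a * fps_X"
    have "fps_deriv (E ^ m) = fps_const (real m) * fps_deriv E * E ^ m'"
      by (simp add: Suc fps_deriv_power del: power_Suc of_nat_Suc)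
    also have "fps_deriv E = - fps_const a" by (simp add: E_def)
    also have "fps_const (real m) * - fps_const a * E ^ m' =
        - (E ^ m' * (fps_const (real m) * fps_const a)) * (E * G a)"
      using G[of a] by (simp add: E_def mult_ac)
    also have "\<dots> = - (E ^ m * (fps_const (real m * a) * G a))"
      by (simp add: Suc mult_ac flip: fps_const_mult del: of_nat_Suc)
    finally show ?thesis by (simp add: E_def)
  qed simp
  have deriv: "fps_deriv (R n) = - (R n * S n)" for n
  proof (induction n)
    case (Suc n)
    have "R (Suc n) = R n * (1 - fps_const (x n) * fps_X) ^ (u ! n)"
      and "S (Suc n) = S n + fps_const (real (u ! n) * x n) * G (x n)"
      by (simp_all add: R_def S_def)
    then show ?case
      by (simp only: fps_deriv_mult pow Suc.IH) (simp add: algebra_simps)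
  qed (simp add: R_def S_def)
  have linear: "fps_of_poly [:1, - a:] = 1 - fps_const a * fps_X" for a :: real
    by (simp add: fps_of_poly_pCons mult.commute flip: fps_const_neg)
  have "fps_of_poly (\<Prod>i<length u. [:1, - x i:] ^ (u ! i)) = R (length u)"
    by (simp only: R_def fps_of_poly_prod fps_of_poly_power linear)
  then have mc: "monic_coeff u x k = fps_nth (R (length u)) k" for k
    by (metis monic_coeff_def fps_of_poly_nth)
  have S: "fps_nth (S (length u)) k = wmoment (length u) (\<lambda>i. u ! i) x (Suc k)" for k
    by (simp add: S_def wmoment_def fps_sum_nth G_def mult_ac)
  have "real (Suc k) * monic_coeff u x (Suc k) = fps_nth (fps_deriv (R (length u))) k"
    by (simp add: mc)
  also have "\<dots> = - (\<Sum>j\<le>k. monic_coeff u x j * wmoment (length u) (\<lambda>i. u ! i) x (Suc (k - j)))"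
    by (simp add: deriv fps_mult_nth mc S atLeast0AtMost)
  finally show ?thesis .
qed

lemma monic_coeff_0 [simp]: "monic_coeff u x 0 = 1"
  by (simp add: monic_coeff_def poly_0_coeff_0[symmetric] poly_prod)

text \<open>Newton's identities for \<open>x\<close> and \<open>y\<close> are subtracted. Summands
  with \<open>j > 0\<close> contain only coefficients and power sums of index at most
  \<open>k\<close>, which agree by assumption and induction; the summand \<open>j = 0\<close> is the
  power sum of exponent \<open>Suc k\<close>.\<close>

lemma wmoment_Suc_diff:
  assumes "\<And>j. 1 \<le> j \<Longrightarrow> j \<le> k \<Longrightarrow> monic_coeff u x j = monic_coeff u y j"
  shows "wmoment (length u) (\<lambda>i. u ! i) y (Suc k) - wmoment (length u) (\<lambda>i. u ! i) x (Suc k) =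
    - real (Suc k) * (monic_coeff u y (Suc k) - monic_coeff u x (Suc k))"
  using assms
proof (induction k rule: less_induct)
  case (less k)
  let ?p = "wmoment (length u) (\<lambda>i. u ! i)"
  have p: "?p x (Suc m) = ?p y (Suc m)" if "m < k" for m
    using less.IH[OF that] less.prems that less.prems[of "Suc m"] by auto
  have split: "(\<Sum>j\<le>k. monic_coeff u z j * ?p z (Suc (k - j))) =
      ?p z (Suc k) + (\<Sum>j\<in>{1..k}. monic_coeff u z j * ?p z (Suc (k - j)))" for z
    by (simp add: atMost_atLeast0 sum.atLeast_Suc_atMost)
  have "(\<Sum>j\<in>{1..k}. monic_coeff u x j * ?p x (Suc (k - j))) =
      (\<Sum>j\<in>{1..k}. monic_coeff u y j * ?p y (Suc (k - j)))"
    by (intro sum.cong refl) (use p less.prems in auto)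
  then show ?case
    using newton_identity[of k u x] newton_identity[of k u y]
    unfolding split by (simp add: algebra_simps)
qed

lemma wmoment_eq:
  assumes "\<And>j. 1 \<le> j \<Longrightarrow> j \<le> m \<Longrightarrow> monic_coeff u x j = monic_coeff u y j" "1 \<le> k" "k \<le> m"
  shows "wmoment (length u) (\<lambda>i. u ! i) x k = wmoment (length u) (\<lambda>i. u ! i) y k"
  using wmoment_Suc_diff[of "k - 1" u x y] assms by auto

lemma monic_coeff_injective:
  assumes "mono_on {..<length u} x" "mono_on {..<length u} y" "\<And>i. i < length u \<Longrightarrow> u ! i > 0"
    and "\<And>k. 1 \<le> k \<Longrightarrow> k \<le> length u \<Longrightarrow> monic_coeff u x k = monic_coeff u y k"
    and "i < length u"
  shows "x i = y i"
  using assms(1-3) wmoment_eq[OF assms(4)] assms(5) by (rule wmoment_injective)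

text \<open>The inequality of \<open>wmoment_extremal\<close> is reversed, because the difference of
  the top power sums is a negative multiple of the difference of the top coefficients.\<close>

lemma monic_coeff_extremal:
  assumes "mono_on {..<length u} x" "mono_on {..<length u} y" "\<And>i. i < length u \<Longrightarrow> u ! i > 0"
    and eq: "\<And>k. 1 \<le> k \<Longrightarrow> k < length u \<Longrightarrow> monic_coeff u x k = monic_coeff u y k"
    and k: "Suc k < length u" "x k = x (Suc k)"
  shows "(-1) ^ (length u - k) * (monic_coeff u y (length u) - monic_coeff u x (length u)) \<le> 0"
proof -
  obtain m where m: "length u = Suc m" using k by (cases "length u") auto
  let ?p = "wmoment (length u) (\<lambda>i. u ! i)"
  have "(-1) ^ (length u - k) * (?p y (length u) - ?p x (length u)) \<ge> 0"
    by (rule wmoment_extremal) (use assms wmoment_eq[of m u x y] m in auto)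
  also have "?p y (length u) - ?p x (length u) =
      - real (Suc m) * (monic_coeff u y (length u) - monic_coeff u x (length u))"
    using wmoment_Suc_diff[of m u x y] eq m by simp
  finally have "0 \<le> - real (Suc m) *
      ((-1) ^ (length u - k) * (monic_coeff u y (length u) - monic_coeff u x (length u)))"
    by (simp only: mult_ac)
  then show ?thesis by (simp add: zero_le_mult_iff mult_le_0_iff del: of_nat_Suc)
qed

section \<open>Factorizations of hyperbolic polynomials along a composition\<close>

lemma strict_merge_roots:
  assumes "length gs = length rs" "sorted_wrt (<) rs" "\<forall>g\<in>set gs. g \<noteq> []"
  shows "\<exists>xs :: real list. length xs = length (concat gs) \<and> sorted xs \<and> set xs = set rs \<and>
    prod_list (map2 (\<lambda>t n. [:- t, 1:] ^ n) xs (concat gs)) =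
    prod_list (map2 (\<lambda>t n. [:- t, 1:] ^ n) rs (map sum_list gs))"
  using assms
proof (induction gs rs rule: list_induct2)
  case (Cons g gs r rs)
  then obtain xs :: "real list" where xs: "length xs = length (concat gs)" "sorted xs" "set xs = set rs"
    "prod_list (map2 (\<lambda>t n. [:- t, 1:] ^ n) xs (concat gs)) =
     prod_list (map2 (\<lambda>t n. [:- t, 1:] ^ n) rs (map sum_list gs))"
    by auto
  have rep: "prod_list (map2 (\<lambda>t n. [:- t, 1:] ^ n) (replicate (length g) r) g) = [:- r, 1:] ^ sum_list g"
    by (induction g) (simp_all add: power_add)
  show ?case
    \<comment> \<open>The root \<open>r\<close> is repeated once for each part in its block; it
      comes first because it is smaller than all later roots.\<close>
    by (rule exI[of _ "replicate (length g) r @ xs"])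
       (use xs Cons.prems rep in \<open>auto simp: sorted_append less_imp_le\<close>)
qed simp

text \<open>Splitting off the full power of one root after another ends with a polynomial without
  real roots, which is constant by hyperbolicity and the fundamental theorem of algebra. The
  induction runs for an arbitrary leading coefficient.\<close>

lemma hyperbolic_factorization:
  assumes "hyperbolic h" "lead_coeff h = 1"
  shows "h = (\<Prod>t | poly h t = 0. [:- t, 1:] ^ order t h)"
proof -
  let ?c = "map_poly complex_of_real"
  have mult: "?c (p * q) = ?c p * ?c q" for p q
    by (rule poly_eqI) (simp add: coeff_map_poly coeff_mult)
  have "h = smult (lead_coeff h) (\<Prod>t | poly h t = 0. [:- t, 1:] ^ order t h)"
    using assms(1)
  proof (induction h rule: poly_root_order_induct)
    case 0
    then show ?case by (simp add: hyperbolic_def)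
  next
    case (no_roots p)
    have "degree p = 0"
    proof (rule ccontr)
      assume "degree p \<noteq> 0"
      then have "degree (?c p) \<noteq> 0" by (simp add: degree_map_poly)
      then have "\<not> constant (poly (?c p))" by (simp only: constant_degree not_False_eq_True)
      then obtain z where z: "poly (?c p) z = 0" using fundamental_theorem_of_algebra by blast
      with no_roots obtain t where "z = of_real t" by (auto simp: hyperbolic_def Reals_def)
      moreover have "poly (?c p) (of_real t) = of_real (poly p t)"
        by (induction p) (simp_all add: map_poly_pCons)
      ultimately show False using z no_roots by simp
    qed
    then obtain a where "p = [:a:]" by (rule degree_eq_zeroE)
    with no_roots show ?case by auto
  next
    case (root p r n)
    from root.prems have "p \<noteq> 0" "hyperbolic p"
      by (auto simp: hyperbolic_def mult)
    let ?h = "[:- r, 1:] ^ n * p"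
    have roots: "{t. poly ?h t = 0} = insert r {t. poly p t = 0}"
      using root by auto
    have ord: "order t ?h = (if t = r then n else order t p)" for t
    proof -
      have "order t ([:- r, 1:] ^ n) = (if t = r then n else 0)"
        by (auto simp: order_power_n_n order_0I)
      then show ?thesis
        using root \<open>p \<noteq> 0\<close> by (auto simp: order_mult order_0I)
    qed
    have "(\<Prod>t | poly ?h t = 0. [:- t, 1:] ^ order t ?h) =
        [:- r, 1:] ^ n * (\<Prod>t | poly p t = 0. [:- t, 1:] ^ order t p)"
      unfolding roots using root \<open>p \<noteq> 0\<close>
      by (subst prod.insert) (auto simp: poly_roots_finite ord intro!: prod.cong)
    moreover have "lead_coeff ?h = lead_coeff p" by (simp add: lead_coeff_mult lead_coeff_power)
    moreover have "?h = smult (lead_coeff p)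
        ([:- r, 1:] ^ n * (\<Prod>t | poly p t = 0. [:- t, 1:] ^ order t p))"
      unfolding mult_smult_right[symmetric] using root.IH[OF \<open>hyperbolic p\<close>] by (rule arg_cong)
    ultimately show ?case by (simp only:)
  qed
  with assms(2) show ?thesis by simp
qed

text \<open>Each multiplicity of \<open>h\<close> is a sum of consecutive parts of \<open>u\<close>;
  repeating its root for each of these parts gives \<open>x\<close>.\<close>

lemma merged_hyperbolic_root_prod:
  assumes "hyperbolic h" "lead_coeff h = 1" "comp_le (mult_comp h) u"
  obtains x where "mono_on {..<length u} x" "h = root_prod u x"
proof -
  define rs where "rs = sorted_list_of_set {t. poly h t = 0}"
  have "h \<noteq> 0" using assms(2) by auto
  then have fin: "finite {t. poly h t = 0}" by (rule poly_roots_finite)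
  from assms(3) obtain gs where gs: "u = concat gs" "\<forall>g\<in>set gs. g \<noteq> []"
    "map (\<lambda>t. order t h) rs = map sum_list gs"
    unfolding comp_le_def mult_comp_def rs_def by blast
  have "length gs = length rs" using gs(3) by (metis length_map)
  moreover have "sorted_wrt (<) rs" by (simp add: rs_def)
  ultimately obtain xs :: "real list" where xs: "length xs = length u" "sorted xs"
    "prod_list (map2 (\<lambda>t n. [:- t, 1:] ^ n) xs u) =
     prod_list (map2 (\<lambda>t n. [:- t, 1:] ^ n) rs (map (\<lambda>t. order t h) rs))"
    using strict_merge_roots[of gs rs] gs by auto
  have "map2 (\<lambda>t n. [:- t, 1:] ^ n) rs (map (\<lambda>t. order t h) rs) = map (\<lambda>t. [:- t, 1:] ^ order t h) rs"
    by (induction rs) auto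
  then have "prod_list (map2 (\<lambda>t n. [:- t, 1:] ^ n) rs (map (\<lambda>t. order t h) rs)) = h"
    using hyperbolic_factorization[OF assms(1,2)] fin
    by (simp add: rs_def prod.distinct_set_conv_list[symmetric])
  with xs have "h = root_prod u (\<lambda>i. xs ! i)"
    by (simp add: prod.list_conv_set_nth root_prod_def atLeast0LessThan)
  moreover have "mono_on {..<length u} (\<lambda>i. xs ! i)"
    using xs by (auto simp: mono_on_def sorted_nth_mono)
  ultimately show ?thesis using that by blast
qed

lemma mult_comp_root_prod:
  assumes "strict_mono_on {..<length u} x" "\<And>i. i < length u \<Longrightarrow> u ! i > 0"
  shows "mult_comp (root_prod u x) = u"
proof -
  have inj: "inj_on x {..<length u}" using assms(1) by (rule strict_mono_on_imp_inj_on)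
  have roots: "{t. poly (root_prod u x) t = 0} = set (map x [0..<length u])"
    using root_prod_roots[OF assms(2)] by (auto simp: atLeast0LessThan)
  have "sorted_wrt (<) (map x [0..<length u])"
    using assms(1) by (auto simp: sorted_wrt_iff_nth_less strict_mono_on_def)
  then have sl: "sorted_list_of_set (set (map x [0..<length u])) = map x [0..<length u]"
    by (simp only: strict_sorted_iff sorted_list_of_set.idem_if_sorted_distinct)
  have ord: "order (x i) (root_prod u x) = u ! i" if "i < length u" for i
  proof -
    let ?q = "\<Prod>j\<in>{..<length u} - {i}. [:- x j, 1:] ^ (u ! j)"
    have "root_prod u x = [:- x i, 1:] ^ (u ! i) * ?q"
      using that by (simp add: root_prod_def prod.remove[of _ i])
    moreover have "poly ?q (x i) \<noteq> 0"
      using inj that by (auto simp: poly_prod inj_on_def)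
    moreover from this have "?q \<noteq> 0" by (metis poly_0)
    ultimately show ?thesis by (simp add: order_mult order_0I order_power_n_n)
  qed
  show ?thesis
    unfolding mult_comp_def roots sl by (rule nth_equalityI) (auto simp: ord)
qed

text \<open>A counting argument: the composition has one entry per distinct root, so length
  \<open>length u\<close> leaves no room for coincidences in \<open>x\<close>.\<close>

lemma strict_mono_on_mult_comp:
  assumes "mono_on {..<length u} x" "\<And>i. i < length u \<Longrightarrow> u ! i > 0"
    and "mult_comp (root_prod u x) = u"
  shows "strict_mono_on {..<length u} x"
proof -
  have "length (mult_comp (root_prod u x)) = card (x ` {..<length u})"
    by (simp add: mult_comp_def root_prod_roots[OF assms(2)])
  then have "inj_on x {..<length u}" using assms(3) by (simp add: inj_on_iff_eq_card)
  with assms(1) show ?thesis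
    by (auto simp: strict_mono_on_def mono_on_def inj_on_def order.order_iff_strict)
qed

lemma comp_le_refl: "comp_le u u"
  unfolding comp_le_def by (rule exI[of _ "map (\<lambda>n. [n]) u"]) (simp add: o_def)

subsection \<open>Dimension and relative interior through an injective projection\<close>

lemma continuous_map_Euclidean_coordinate: "continuous_map (Euclidean_space n) euclideanreal (\<lambda>x. x i)"
  unfolding Euclidean_space_def
  by (intro continuous_map_from_subtopology continuous_map_product_projection) simp

lemma Euclidean_space_eq_top_of_set: "Euclidean_space n = top_of_set {x. \<forall>i\<ge>n. x i = 0}"
  by (simp add: Euclidean_space_def euclidean_product_topology)

text \<open>This shows below that an open set cannot lie in a coordinate hyperplane, and later lets
  the last retained coefficient move in a chosen direction.\<close>

lemma openin_Euclidean_space_fun_upd: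
  assumes "openin (Euclidean_space n) V" "p \<in> V" "i < n"
  shows "\<exists>e>0. \<forall>t. \<bar>t - p i\<bar> < e \<longrightarrow> p(i := t) \<in> V"
proof -
  have p: "p \<in> topspace (Euclidean_space n)" using assms openin_subset by blast
  \<comment> \<open>This is \<open>p(i := t)\<close> with the cutoff at \<open>n\<close> made
    explicit, the form that the componentwise criterion for continuity expects.\<close>
  let ?g = "\<lambda>t j. if j < n then (if j = i then t else p j) else 0"
  have upd: "?g t = p(i := t)" for t
    using p assms(3) by (auto simp: topspace_Euclidean_space)
  have "continuous_map euclideanreal (Euclidean_space n) ?g"
    by (subst continuous_map_componentwise_Euclidean_space) auto
  then have "openin euclideanreal {t \<in> topspace euclideanreal. ?g t \<in> V}"
    using assms(1) by (rule openin_continuous_map_preimage)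
  then have "open {t. p(i := t) \<in> V}" by (simp only: upd) simp
  moreover have "p i \<in> {t. p(i := t) \<in> V}" using assms(2) by simp
  ultimately show ?thesis unfolding open_dist dist_real_def by blast
qed

text \<open>For \<open>m < n\<close> the smaller space is a coordinate subspace of the larger one.
  By invariance of domain the image of \<open>W\<close> would be open in the larger space, although
  coordinate \<open>m\<close> vanishes on it.\<close>

lemma Euclidean_injective_dim_le:
  assumes W: "openin (Euclidean_space n) W" "W \<noteq> {}"
    and cont: "continuous_map (subtopology (Euclidean_space n) W) (Euclidean_space m) f"
    and inj: "inj_on f W"
  shows "n \<le> m"
proof (rule ccontr)
  assume "\<not> n \<le> m"
  then have "m < n" by simp
  have eq: "Euclidean_space m = subtopology (Euclidean_space n) {x. \<forall>i\<ge>m. x i = 0}"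
    using \<open>m < n\<close> unfolding Euclidean_space_def subtopology_subtopology
    by (rule_tac arg_cong[of _ _ "subtopology _"]) auto
  have "continuous_map (subtopology (Euclidean_space n) W) (Euclidean_space n) f"
    using cont unfolding eq by (rule continuous_map_into_fulltopology)
  then have "openin (Euclidean_space n) (f ` W)"
    using W inj by (intro invariance_of_domain_Euclidean_space)
  moreover obtain w where "w \<in> W" using W by blast
  moreover from this have "f w \<in> f ` W" by (rule imageI)
  ultimately obtain e where e: "e > 0" "\<forall>t. \<bar>t - f w m\<bar> < e \<longrightarrow> (f w)(m := t) \<in> f ` W"
    using \<open>m < n\<close> openin_Euclidean_space_fun_upd by blast
  have zero: "y m = 0" if "y \<in> f ` W" for y
  proof -
    have "f ` topspace (subtopology (Euclidean_space n) W) \<subseteq> topspace (Euclidean_space m)"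
      using cont by (rule continuous_map_image_subset_topspace)
    moreover have "topspace (subtopology (Euclidean_space n) W) = W"
      using openin_subset[OF W(1)] by auto
    ultimately have "y \<in> topspace (Euclidean_space m)" using that by auto
    then show ?thesis by (simp add: topspace_Euclidean_space)
  qed
  have "f w m = 0" using zero \<open>w \<in> W\<close> by blast
  then have "(f w)(m := e / 2) \<in> f ` W"
    using e by simp
  from zero[OF this] e(1) show False by simp
qed

text \<open>Composing \<open>p\<close> with the chart of a cell in \<open>S\<close> bounds the
  dimension of that cell by \<open>m\<close>, and the cell assumed to exist attains the
  bound.\<close>

lemma sa_dim_eqI:
  assumes cont: "continuous_map (subtopology X S) (Euclidean_space m) p" and inj: "inj_on p S"
    and "S \<subseteq> topspace X" and "has_open_cell X S m"
  shows "sa_dim X S = m"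
  unfolding sa_dim_def
proof (rule Greatest_equality)
  fix n assume "has_open_cell X S n"
  then obtain U W where U: "U \<subseteq> S" "U \<noteq> {}" and W: "openin (Euclidean_space n) W"
    and "subtopology X U homeomorphic_space subtopology (Euclidean_space n) W"
    unfolding has_open_cell_def by blast
  then obtain g where g: "homeomorphic_map (subtopology (Euclidean_space n) W) (subtopology X U) g"
    using homeomorphic_space homeomorphic_space_sym by metis
  have tW: "topspace (subtopology (Euclidean_space n) W) = W"
    using openin_subset[OF W] by auto
  have tU: "topspace (subtopology X U) = U" using U assms(3) by auto
  have gW: "g ` W = U" using homeomorphic_imp_surjective_map[OF g] by (simp only: tW tU)
  have "continuous_map (subtopology X U) (Euclidean_space m) p"
    using cont U(1) by (rule continuous_map_from_subtopology_mono)
  with homeomorphic_imp_continuous_map[OF g]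
  have "continuous_map (subtopology (Euclidean_space n) W) (Euclidean_space m) (p \<circ> g)"
    by (rule continuous_map_compose)
  moreover have "inj_on (p \<circ> g) W"
    using homeomorphic_imp_injective_map[OF g] inj U(1) gW
    by (simp only: tW) (metis comp_inj_on inj_on_subset)
  ultimately show "n \<le> m" using U(2) gW W by (intro Euclidean_injective_dim_le) auto
qed (rule assms(4))

lemma rel_int_dim_image_interior:
  assumes cont: "continuous_map (subtopology X S) (Euclidean_space (sa_dim X S)) p"
    and inj: "inj_on p S" and S: "S \<subseteq> topspace X" and a: "a \<in> rel_int_dim X S"
  obtains V where "openin (Euclidean_space (sa_dim X S)) V" "p a \<in> V" "V \<subseteq> p ` S"
proof -
  let ?E = "Euclidean_space (sa_dim X S)"
  from a obtain N W where N: "openin (subtopology X S) N" "a \<in> N" and W: "openin ?E W"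
    and "subtopology X N homeomorphic_space subtopology ?E W"
    unfolding rel_int_dim_def by blast
  then obtain g where g: "homeomorphic_map (subtopology ?E W) (subtopology X N) g"
    using homeomorphic_space homeomorphic_space_sym by metis
  have "N \<subseteq> S" using N(1) by (rule openin_imp_subset)
  have tW: "topspace (subtopology ?E W) = W"
    using openin_subset[OF W] by auto
  have tN: "topspace (subtopology X N) = N" using \<open>N \<subseteq> S\<close> S by auto
  have gW: "g ` W = N" using homeomorphic_imp_surjective_map[OF g] by (simp only: tW tN)
  have "continuous_map (subtopology X N) ?E p"
    using cont \<open>N \<subseteq> S\<close> by (rule continuous_map_from_subtopology_mono)
  with homeomorphic_imp_continuous_map[OF g]
  have "continuous_map (subtopology ?E W) ?E (p \<circ> g)"
    by (rule continuous_map_compose)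
  moreover have "inj_on (p \<circ> g) W"
    using homeomorphic_imp_injective_map[OF g] inj \<open>N \<subseteq> S\<close> gW
    by (simp only: tW) (metis comp_inj_on inj_on_subset)
  ultimately have "openin ?E ((p \<circ> g) ` W)"
    using W by (intro invariance_of_domain_Euclidean_space)
  moreover have "(p \<circ> g) ` W = p ` N" using gW by (metis image_comp)
  ultimately show ?thesis using that[of "p ` N"] N(2) \<open>N \<subseteq> S\<close> by auto
qed

subsection \<open>Strata\<close>

definition open_chamber :: "nat \<Rightarrow> (nat \<Rightarrow> real) set" where
  "open_chamber n = {x \<in> topspace (Euclidean_space n). strict_mono_on {..<n} x}"

lemma openin_open_chamber: "openin (Euclidean_space n) (open_chamber n)"
proof -
  have "open (\<Inter>i<n. \<Inter>j\<in>{i<..<n}. {x :: nat \<Rightarrow> real. x i < x j})"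
    by (intro open_INT finite_lessThan finite_greaterThanLessThan ballI open_Collect_less
        continuous_on_product_coordinates)
  then have "openin (Euclidean_space n)
      ({x. \<forall>i\<ge>n. x i = 0} \<inter> (\<Inter>i<n. \<Inter>j\<in>{i<..<n}. {x. x i < x j}))"
    unfolding Euclidean_space_eq_top_of_set by (rule openin_open_Int)
  moreover have "open_chamber n = {x. \<forall>i\<ge>n. x i = 0} \<inter> (\<Inter>i<n. \<Inter>j\<in>{i<..<n}. {x. x i < x j})"
    by (auto simp: open_chamber_def topspace_Euclidean_space strict_mono_on_def)
  ultimately show ?thesis by simp
qed

section \<open>Continuous dependence of the coefficients on the roots\<close>

lemma continuous_map_coeff_mult:
  fixes p q :: "'a \<Rightarrow> real poly"
  assumes "\<And>k. continuous_map X euclideanreal (\<lambda>x. coeff (p x) k)"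
    and "\<And>k. continuous_map X euclideanreal (\<lambda>x. coeff (q x) k)"
  shows "continuous_map X euclideanreal (\<lambda>x. coeff (p x * q x) k)"
  unfolding coeff_mult by (intro continuous_map_sum continuous_map_real_mult assms) simp

lemma continuous_map_monic_coeff:
  assumes "\<And>i. i < length u \<Longrightarrow> continuous_map X euclideanreal (\<lambda>z. g z i)"
  shows "continuous_map X euclideanreal (\<lambda>z. monic_coeff u (g z) k)"
proof -
  have pow: "continuous_map X euclideanreal (\<lambda>z. coeff ([:1, - g z i:] ^ m) k)" if "i < length u" for i m k
  proof (induction m arbitrary: k)
    case 0
    then show ?case by simp
  next
    case (Suc m)
    have "continuous_map X euclideanreal (\<lambda>z. coeff [:1, - g z i:] k)" for k
    proof -
      have "continuous_map X euclideanreal (\<lambda>z. - g z i)"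
        by (intro continuous_map_minus assms that)
      then show ?thesis by (cases k; cases "k - 1") (simp_all add: coeff_pCons)
    qed
    then show ?case unfolding power_Suc by (intro continuous_map_coeff_mult Suc.IH)
  qed
  have "continuous_map X euclideanreal (\<lambda>z. coeff (\<Prod>i<n. [:1, - g z i:] ^ (u ! i)) k)"
    if "n \<le> length u" for n k
    using that
  proof (induction n arbitrary: k)
    case (Suc n)
    then show ?case unfolding prod.lessThan_Suc by (intro continuous_map_coeff_mult pow) auto
  qed simp
  then show ?thesis by (simp add: monic_coeff_def)
qed

lemma monic_coeff_cong:
  assumes "\<And>i. i < length u \<Longrightarrow> x i = y i"
  shows "monic_coeff u x k = monic_coeff u y k"
proof -
  have "(\<Prod>i<length u. [:1, - x i:] ^ (u ! i)) = (\<Prod>i<length u. [:1, - y i:] ^ (u ! i))"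
    using assms by (intro prod.cong) auto
  then show ?thesis by (simp add: monic_coeff_def)
qed

text \<open>Serves both to forget the coefficients beyond the one of index \<open>length u\<close>
  and to turn a root sequence into a point of Euclidean space.\<close>

definition truncate :: "nat \<Rightarrow> (nat \<Rightarrow> real) \<Rightarrow> nat \<Rightarrow> real" where
  "truncate n a = (\<lambda>i. if i < n then a i else 0)"

lemma root_prod_cong:
  assumes "\<And>i. i < length u \<Longrightarrow> x i = y i"
  shows "root_prod u x = root_prod u y"
  unfolding root_prod_def using assms by (intro prod.cong) auto

section \<open>Parametrisation of a stratum by feasible root sequences\<close>

locale stratum =
  fixes d s :: nat and f :: "real poly" and u :: "nat list"
  assumes s_le_d: "s \<le> d" and comp_u: "composition d u"
    and top_nonempty: "\<exists>h \<in> Hsu d s f u. mult_comp h = u"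
begin

abbreviation "cell \<equiv> coords d s ` Hsu d s f u"
abbreviation "top_cell \<equiv> coords d s ` {h \<in> Hsu d s f u. mult_comp h = u}"
abbreviation "proj \<equiv> truncate (length u - s)"

definition feasible :: "(nat \<Rightarrow> real) \<Rightarrow> bool" where
  "feasible x \<longleftrightarrow> (\<forall>k. 1 \<le> k \<and> k \<le> s \<longrightarrow> monic_coeff u x k = hcoef d f k)"

lemma u_pos: "i < length u \<Longrightarrow> u ! i > 0"
  using comp_u by (auto simp: composition_def)

lemma sum_list_u: "sum_list u = d"
  using comp_u by (simp add: composition_def)

lemma length_u_le: "length u \<le> d"
proof -
  have "(\<Sum>i<length u. 1) \<le> (\<Sum>i<length u. u ! i)"
    using u_pos by (intro sum_mono) (auto simp: Suc_le_eq)
  then show ?thesis by (simp add: sum_list_u[symmetric] sum_list_sum_nth atLeast0LessThan)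
qed

lemma hcoef_root_prod_u: "k \<le> d \<Longrightarrow> hcoef d (root_prod u x) k = monic_coeff u x k"
  using hcoef_root_prod[of k u x] by (simp add: sum_list_u)

lemma coords_root_prod:
  "coords d s (root_prod u x) = (\<lambda>i. if i < d - s then monic_coeff u x (s + 1 + i) else 0)"
  by (auto simp: coords_def fun_eq_iff hcoef_root_prod_u)

lemma Hsu_root_prod:
  assumes "h \<in> Hsu d s f u"
  obtains x where "mono_on {..<length u} x" "feasible x" "h = root_prod u x"
proof -
  from assms have h: "lead_coeff h = 1" "hyperbolic h" "comp_le (mult_comp h) u"
    "\<And>k. 1 \<le> k \<Longrightarrow> k \<le> s \<Longrightarrow> hcoef d h k = hcoef d f k"
    by (auto simp: Hsu_def Hs_def)
  from merged_hyperbolic_root_prod[OF h(2,1,3)]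
  obtain x where x: "mono_on {..<length u} x" "h = root_prod u x" .
  moreover have "feasible x"
    using h(4) s_le_d by (auto simp: feasible_def x(2) hcoef_root_prod_u)
  ultimately show ?thesis using that by blast
qed

lemma root_prod_in_top:
  assumes "strict_mono_on {..<length u} x" "feasible x"
  shows "root_prod u x \<in> {h \<in> Hsu d s f u. mult_comp h = u}"
proof -
  have "mult_comp (root_prod u x) = u" using assms(1) u_pos by (rule mult_comp_root_prod)
  moreover have "lead_coeff (root_prod u x) = 1" by (rule lead_coeff_root_prod)
  ultimately show ?thesis
    using assms(2) s_le_d
    by (auto simp: Hsu_def Hs_def comp_le_refl hyperbolic_root_prod sum_list_u feasible_def
        hcoef_root_prod_u)
qed

lemma top_root_prod:
  assumes "h \<in> Hsu d s f u" "mult_comp h = u"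
  obtains x where "strict_mono_on {..<length u} x" "feasible x" "h = root_prod u x"
proof -
  obtain x where x: "mono_on {..<length u} x" "feasible x" "h = root_prod u x"
    using Hsu_root_prod[OF assms(1)] .
  moreover have "strict_mono_on {..<length u} x"
    using strict_mono_on_mult_comp[OF x(1) u_pos] assms(2) x(3) by simp
  ultimately show ?thesis using that by blast
qed

section \<open>The projection to the first coefficients and its chart on the top cell\<close>

lemma feasible_eqI:
  assumes x: "mono_on {..<length u} x" "feasible x" and y: "mono_on {..<length u} y" "feasible y"
    and "\<And>k. s < k \<Longrightarrow> k \<le> length u \<Longrightarrow> monic_coeff u x k = monic_coeff u y k" "i < length u"
  shows "x i = y i"
proof (rule monic_coeff_injective[OF x(1) y(1) u_pos _ assms(6)])
  fix k assume "1 \<le> k" "k \<le> length u"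
  then show "monic_coeff u x k = monic_coeff u y k"
    using x(2) y(2) assms(5) by (cases "k \<le> s") (auto simp: feasible_def)
qed

lemma proj_coords_root_prod:
  "i < length u - s \<Longrightarrow> proj (coords d s (root_prod u x)) i = monic_coeff u x (s + 1 + i)"
  using length_u_le by (simp add: truncate_def coords_root_prod)

text \<open>The prescribed coefficients and the retained ones together include the first
  \<open>length u\<close>, and these determine the roots.\<close>

lemma inj_on_proj: "inj_on proj cell"
proof (rule inj_onI)
  fix a b assume a: "a \<in> cell" and b: "b \<in> cell" and ab: "proj a = proj b"
  obtain x where x: "mono_on {..<length u} x" "feasible x" "a = coords d s (root_prod u x)"
    using a Hsu_root_prod by (metis imageE)
  obtain y where y: "mono_on {..<length u} y" "feasible y" "b = coords d s (root_prod u y)"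
    using b Hsu_root_prod by (metis imageE)
  have "x i = y i" if "i < length u" for i
  proof (rule feasible_eqI[OF x(1,2) y(1,2) _ that])
    fix k assume "s < k" "k \<le> length u"
    then show "monic_coeff u x k = monic_coeff u y k"
      using proj_coords_root_prod[of "k - s - 1" x] proj_coords_root_prod[of "k - s - 1" y] ab x(3) y(3)
      by simp
  qed
  then have "root_prod u x = root_prod u y" by (rule root_prod_cong)
  then show "a = b" using x(3) y(3) by simp
qed

lemma cell_subset: "cell \<subseteq> topspace (Euclidean_space (d - s))"
  by (auto simp: topspace_Euclidean_space coords_def)

lemma continuous_map_proj:
  "continuous_map (Euclidean_space (d - s)) (Euclidean_space (length u - s)) proj"
  unfolding truncate_def
  by (subst continuous_map_componentwise_Euclidean_space) (simp add: continuous_map_Euclidean_coordinate)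

text \<open>By invariance of domain, the coefficient map \<open>\<Psi>\<close> is a homeomorphism
  from the open chamber onto an open set. Slicing that set at the prescribed coefficients gives
  \<open>W\<close>, and the inverse of \<open>\<Psi>\<close> yields the inverse \<open>G\<close> of
  \<open>proj\<close>.\<close>

lemma top_cell_chart:
  obtains W where "openin (Euclidean_space (length u - s)) W"
    "top_cell = {a \<in> cell. proj a \<in> W}"
    "subtopology (Euclidean_space (d - s)) top_cell homeomorphic_space
     subtopology (Euclidean_space (length u - s)) W"
proof -
  let ?l = "length u"
  let ?E = "Euclidean_space ?l" and ?D = "open_chamber ?l"
  define \<Psi> where "\<Psi> x = (\<lambda>i. if i < ?l then monic_coeff u x (Suc i) else 0)" for x
  have coord: "continuous_map (subtopology (Euclidean_space m) S) euclideanreal (\<lambda>x. x i)" for m S i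
    by (intro continuous_map_from_subtopology continuous_map_Euclidean_coordinate)
  have tD: "topspace (subtopology ?E ?D) = ?D" by (auto simp: open_chamber_def)
  have cont\<Psi>: "continuous_map (subtopology ?E ?D) ?E \<Psi>"
    unfolding \<Psi>_def
    by (subst continuous_map_componentwise_Euclidean_space)
       (intro allI impI continuous_map_monic_coeff coord)
  have mono: "mono_on {..<?l} x" if "strict_mono_on {..<?l} x" for x :: "nat \<Rightarrow> real"
    using that by (rule strict_mono_on_imp_mono_on)
  have "inj_on \<Psi> ?D"
  proof (rule inj_onI)
    fix x y assume xy: "x \<in> ?D" "y \<in> ?D" "\<Psi> x = \<Psi> y"
    have "x i = y i" if "i < ?l" for i
    proof (rule monic_coeff_injective[OF _ _ u_pos _ that])
      fix k assume "1 \<le> k" "k \<le> ?l"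
      then show "monic_coeff u x k = monic_coeff u y k"
        using fun_cong[OF xy(3), of "k - 1"] by (cases k) (simp_all add: \<Psi>_def)
    qed (use xy mono in \<open>auto simp: open_chamber_def\<close>)
    then show "x = y"
      using xy(1,2) by (auto simp: open_chamber_def topspace_Euclidean_space fun_eq_iff) (metis not_le)
  qed
  with openin_open_chamber cont\<Psi>
  have "openin ?E (\<Psi> ` ?D)" and emb: "embedding_map (subtopology ?E ?D) ?E \<Psi>"
    by (rule invariance_of_domain_Euclidean_space,
        rule invariance_of_domain_Euclidean_space_embedding_map)
  from emb obtain \<Phi> where "homeomorphic_maps (subtopology ?E ?D) (subtopology ?E (\<Psi> ` ?D)) \<Psi> \<Phi>"
    unfolding embedding_map_def tD homeomorphic_map_maps by blast
  moreover have "topspace (subtopology ?E (\<Psi> ` ?D)) = \<Psi> ` ?D"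
    using openin_subset[OF \<open>openin ?E (\<Psi> ` ?D)\<close>] by auto
  ultimately have cont\<Phi>: "continuous_map (subtopology ?E (\<Psi> ` ?D)) (subtopology ?E ?D) \<Phi>"
    and \<Phi>\<Psi>: "\<And>x. x \<in> ?D \<Longrightarrow> \<Phi> (\<Psi> x) = x"
    unfolding homeomorphic_maps_def tD by auto

  \<comment> \<open>\<open>J\<close> puts the prescribed coefficients in front of \<open>w\<close>;
    it is constant if \<open>length u \<le> s\<close>.\<close>
  define J where "J w = (\<lambda>i. if i < ?l then (if i < s then hcoef d f (Suc i) else w (i - s)) else 0)" for w
  have contJ: "continuous_map (Euclidean_space (?l - s)) ?E J"
    unfolding J_def
  proof (subst continuous_map_componentwise_Euclidean_space, intro allI impI)
    show "continuous_map (Euclidean_space (?l - s)) euclideanreal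
        (\<lambda>w. if i < s then hcoef d f (Suc i) else w (i - s))" for i
      by (cases "i < s") (simp_all add: continuous_map_Euclidean_coordinate)
  qed
  define W where "W = {w \<in> topspace (Euclidean_space (?l - s)). J w \<in> \<Psi> ` ?D}"
  have openW: "openin (Euclidean_space (?l - s)) W"
    unfolding W_def using contJ \<open>openin ?E (\<Psi> ` ?D)\<close> by (rule openin_continuous_map_preimage)
  define G where "G w = coords d s (root_prod u (\<Phi> (J w)))" for w

  have W_chamber: "\<Phi> (J w) \<in> ?D \<and> \<Psi> (\<Phi> (J w)) = J w" if "w \<in> W" for w
    using that \<Phi>\<Psi> by (auto simp: W_def)
  have W_coeff: "monic_coeff u (\<Phi> (J w)) (Suc i) = J w i" if "w \<in> W" "i < ?l" for w i
    using W_chamber[OF that(1)] that(2) by (metis \<Psi>_def)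
  have feas: "feasible (\<Phi> (J w))" if w: "w \<in> W" for w
  proof -
    let ?x = "\<Phi> (J w)"
    have low: "monic_coeff u ?x k = hcoef d f k" if "1 \<le> k" "k \<le> s" "k \<le> ?l" for k
      using W_coeff[OF w, of "k - 1"] that by (cases k) (simp_all add: J_def)
    show ?thesis
    proof (cases "s \<le> ?l")
      case True
      then show ?thesis using low by (simp add: feasible_def)
    next
      case False
      \<comment> \<open>Prescribed coefficients of index above \<open>length u\<close> are not seen
        by \<open>J\<close>. They are correct because the first \<open>length u\<close> coefficients
        already force the roots to be those of a polynomial in the top stratum.\<close>
      obtain h where "h \<in> Hsu d s f u" "mult_comp h = u" using top_nonempty by blast
      then obtain y where y: "strict_mono_on {..<?l} y" "feasible y" by (rule top_root_prod)
      have "?x i = y i" if "i < ?l" for i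
      proof (rule monic_coeff_injective[OF _ mono[OF y(1)] u_pos _ that])
        show "mono_on {..<?l} ?x" using W_chamber[OF w] mono by (simp add: open_chamber_def)
        show "monic_coeff u ?x k = monic_coeff u y k" if "1 \<le> k" "k \<le> ?l" for k
          using low[of k] y(2) that False by (simp add: feasible_def)
      qed
      then have "monic_coeff u ?x k = monic_coeff u y k" for k by (rule monic_coeff_cong)
      with y(2) show ?thesis by (simp add: feasible_def)
    qed
  qed
  have G_top: "G w \<in> top_cell" if "w \<in> W" for w
    unfolding G_def
    using root_prod_in_top[OF _ feas[OF that]] W_chamber[OF that] by (auto simp: open_chamber_def)
  have projG: "proj (G w) = w" if w: "w \<in> W" for w
  proof
    fix i show "proj (G w) i = w i"
    proof (cases "i < ?l - s")
      case True
      then have "proj (G w) i = monic_coeff u (\<Phi> (J w)) (Suc (s + i))"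
        by (simp add: G_def proj_coords_root_prod)
      also have "\<dots> = w i" using True by (subst W_coeff[OF w]) (simp_all add: J_def)
      finally show ?thesis .
    next
      case False
      then show ?thesis using w by (simp add: truncate_def W_def topspace_Euclidean_space)
    qed
  qed
  have top: "proj a \<in> W \<and> G (proj a) = a" if "a \<in> top_cell" for a
  proof -
    from that obtain h where h: "h \<in> Hsu d s f u" "mult_comp h = u" and a: "a = coords d s h"
      by blast
    from top_root_prod[OF h] obtain x where
      "strict_mono_on {..<?l} x" "feasible x" "h = root_prod u x" .
    with a have x: "strict_mono_on {..<?l} x" "feasible x" "a = coords d s (root_prod u x)"
      by simp_all
    \<comment> \<open>The cutoff turns the root sequence into a point of the chamber without
      changing the polynomial.\<close>
    let ?x = "truncate ?l x"
    have D: "?x \<in> ?D"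
      using x(1) by (auto simp: open_chamber_def topspace_Euclidean_space truncate_def strict_mono_on_def)
    have mc: "monic_coeff u ?x k = monic_coeff u x k" for k
      by (rule monic_coeff_cong) (simp add: truncate_def)
    have "J (proj a) i = \<Psi> ?x i" for i
      using x(2) by (auto simp: J_def \<Psi>_def mc feasible_def x(3) proj_coords_root_prod)
    then have J: "J (proj a) = \<Psi> ?x" by blast
    have "root_prod u ?x = root_prod u x"
      by (rule root_prod_cong) (simp add: truncate_def)
    then have "G (proj a) = a" by (simp only: G_def J \<Phi>\<Psi>[OF D] x(3)[symmetric])
    moreover have "proj a \<in> W"
      using D J by (auto simp: W_def topspace_Euclidean_space truncate_def)
    ultimately show ?thesis by blast
  qed
  have sub: "top_cell \<subseteq> cell" by blast
  have "top_cell = {a \<in> cell. proj a \<in> W}"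
  proof (intro equalityI subsetI CollectI conjI)
    fix a assume "a \<in> {a \<in> cell. proj a \<in> W}"
    then have a: "a \<in> cell" "proj a \<in> W" by auto
    \<comment> \<open>Both points lie in \<open>cell\<close> and have the same projection.\<close>
    have "G (proj a) = a"
      using inj_on_proj a G_top[OF a(2)] projG[OF a(2)] sub by (meson inj_onD subsetD)
    then show "a \<in> top_cell" using G_top[OF a(2)] by simp
  qed (use top sub in blast)+
  moreover have "homeomorphic_maps (subtopology (Euclidean_space (d - s)) top_cell)
      (subtopology (Euclidean_space (?l - s)) W) proj G"
    unfolding homeomorphic_maps_def
  proof (intro conjI ballI)
    show "continuous_map (subtopology (Euclidean_space (d - s)) top_cell)
        (subtopology (Euclidean_space (?l - s)) W) proj"
      by (intro continuous_map_into_subtopology continuous_map_from_subtopology continuous_map_proj)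
         (use top in auto)
    have "continuous_map (subtopology (Euclidean_space (?l - s)) W) (subtopology ?E (\<Psi> ` ?D)) J"
      by (intro continuous_map_into_subtopology continuous_map_from_subtopology contJ)
         (auto simp: W_def)
    from continuous_map_compose[OF this cont\<Phi>]
    have "continuous_map (subtopology (Euclidean_space (?l - s)) W) ?E (\<Phi> \<circ> J)"
      by (rule continuous_map_into_fulltopology)
    from continuous_map_compose[OF this continuous_map_Euclidean_coordinate]
    have "continuous_map (subtopology (Euclidean_space (?l - s)) W) euclideanreal (\<lambda>w. \<Phi> (J w) i)" for i
      by (simp add: o_def)
    then have "continuous_map (subtopology (Euclidean_space (?l - s)) W) (Euclidean_space (d - s)) G"
      unfolding G_def coords_root_prod
      by (subst continuous_map_componentwise_Euclidean_space)
         (intro allI impI continuous_map_monic_coeff)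
    then show "continuous_map (subtopology (Euclidean_space (?l - s)) W)
        (subtopology (Euclidean_space (d - s)) top_cell) G"
      by (intro continuous_map_into_subtopology) (use G_top in auto)
  qed (use top projG in auto)
  ultimately show ?thesis
    by (rule that[OF openW _ homeomorphic_maps_imp_homeomorphic_space])
qed

text \<open>A neighbourhood of \<open>proj a\<close> inside the image would let the coefficient of
  index \<open>length u\<close> move both ways with the earlier ones fixed, but a double root
  permits only one direction.\<close>

lemma proj_not_interior:
  assumes a: "a \<in> cell" "a \<notin> top_cell"
    and V: "openin (Euclidean_space (length u - s)) V" "proj a \<in> V"
  shows "\<not> V \<subseteq> proj ` cell"
proof
  assume VA: "V \<subseteq> proj ` cell"
  let ?l = "length u"
  obtain x where x: "mono_on {..<?l} x" "feasible x" "a = coords d s (root_prod u x)"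
    using a(1) Hsu_root_prod by (metis imageE)
  have "\<not> strict_mono_on {..<?l} x"
    using root_prod_in_top[OF _ x(2)] a(2) x(3) by blast
  then obtain i j where ij: "i < j" "j < ?l" "x j \<le> x i"
    by (auto simp: strict_mono_on_def not_less)
  then have k: "Suc i < ?l" "x i = x (Suc i)"
    using x(1) by (auto simp: mono_on_def intro!: antisym order.trans[of "x (Suc i)" "x j" "x i"])
  \<comment> \<open>Otherwise \<open>proj\<close> is constant, so by injectivity \<open>cell\<close>
    is a single point, and that point lies in \<open>top_cell\<close>.\<close>
  have "s < ?l"
  proof (rule ccontr)
    assume "\<not> s < ?l"
    obtain h where h: "h \<in> Hsu d s f u" "mult_comp h = u" using top_nonempty by blast
    have "proj (coords d s h) = proj a" using \<open>\<not> s < ?l\<close> by (simp add: truncate_def)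
    then have "coords d s h = a" using inj_on_proj a(1) h(1) by (auto dest: inj_onD)
    with h a(2) show False by blast
  qed
  then have "proj a (?l - s - 1) = monic_coeff u x (s + 1 + (?l - s - 1))"
    unfolding x(3) by (intro proj_coords_root_prod) simp
  also have "s + 1 + (?l - s - 1) = ?l" using \<open>s < ?l\<close> by simp
  finally have pa: "proj a (?l - s - 1) = monic_coeff u x ?l" .
  have "?l - s - 1 < ?l - s" using \<open>s < ?l\<close> by simp
  from openin_Euclidean_space_fun_upd[OF V this] obtain e where
    e: "e > 0" "\<forall>t. \<bar>t - proj a (?l - s - 1)\<bar> < e \<longrightarrow> (proj a)(?l - s - 1 := t) \<in> V"
    by blast
  \<comment> \<open>The coefficient of index \<open>length u\<close>, which is the last coordinate
    of the projection, is moved by \<open>e / 2\<close> in the direction that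
    \<open>monic_coeff_extremal\<close> excludes for the double root at \<open>i\<close>.\<close>
  define t where "t = monic_coeff u x ?l + (-1) ^ (?l - i) * (e / 2)"
  have "\<bar>t - proj a (?l - s - 1)\<bar> < e" unfolding t_def pa using e(1) by (simp add: abs_mult power_abs)
  then have "(proj a)(?l - s - 1 := t) \<in> proj ` cell" using e(2) VA by blast
  then obtain h where h: "h \<in> Hsu d s f u" "proj (coords d s h) = (proj a)(?l - s - 1 := t)" by auto
  obtain y where y: "mono_on {..<?l} y" "feasible y" "h = root_prod u y"
    using Hsu_root_prod[OF h(1)] .
  have yk: "monic_coeff u y k = ((proj a)(?l - s - 1 := t)) (k - s - 1)" if "s < k" "k \<le> ?l" for k
    using proj_coords_root_prod[of "k - s - 1" y] that h(2) y(3) by simp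
  have "(-1) ^ (?l - i) * (monic_coeff u y ?l - monic_coeff u x ?l) \<le> 0"
  proof (rule monic_coeff_extremal[OF x(1) y(1) u_pos _ k])
    fix k assume "1 \<le> k" "k < ?l"
    then show "monic_coeff u x k = monic_coeff u y k"
      using x(2) y(2) yk[of k] proj_coords_root_prod[of "k - s - 1" x] x(3)
      by (cases "k \<le> s") (auto simp: feasible_def)
  qed
  moreover have "monic_coeff u y ?l - monic_coeff u x ?l = (-1) ^ (?l - i) * (e / 2)"
    using yk[of ?l] \<open>s < ?l\<close> by (simp add: t_def)
  moreover have "(-1 :: real) ^ (?l - i) * ((-1) ^ (?l - i) * (e / 2)) = e / 2"
    by (simp flip: mult.assoc power_mult_distrib)
  ultimately show False using e(1) by simp
qed

theorem sa_dim_cell: "sa_dim (Euclidean_space (d - s)) cell = length u - s"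
proof (rule sa_dim_eqI[where p = proj])
  obtain W where W: "openin (Euclidean_space (length u - s)) W"
    "top_cell = {a \<in> cell. proj a \<in> W}"
    "subtopology (Euclidean_space (d - s)) top_cell homeomorphic_space
     subtopology (Euclidean_space (length u - s)) W"
    using top_cell_chart .
  have "top_cell \<subseteq> cell" "top_cell \<noteq> {}" using top_nonempty by auto
  with W(1,3) show "has_open_cell (Euclidean_space (d - s)) cell (length u - s)"
    unfolding has_open_cell_def by blast
qed (intro continuous_map_from_subtopology continuous_map_proj inj_on_proj cell_subset)+

text \<open>An interior point of \<open>cell\<close> is sent by \<open>proj\<close> to an interior
  point of the image, hence lies in \<open>top_cell\<close>. Conversely, \<open>top_cell\<close> is
  open in \<open>cell\<close>, being the preimage of \<open>W\<close>, and so is itself a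
  neighbourhood with a chart.\<close>

theorem rel_int_dim_cell: "rel_int_dim (Euclidean_space (d - s)) cell = top_cell"
proof (intro equalityI subsetI)
  let ?X = "Euclidean_space (d - s)"
  have cont: "continuous_map (subtopology ?X cell) (Euclidean_space (length u - s)) proj"
    by (intro continuous_map_from_subtopology continuous_map_proj)
  fix a
  {
    assume a: "a \<in> rel_int_dim ?X cell"
    then obtain V where "openin (Euclidean_space (length u - s)) V" "proj a \<in> V" "V \<subseteq> proj ` cell"
      using rel_int_dim_image_interior[of ?X cell proj a] cont inj_on_proj cell_subset
      unfolding sa_dim_cell by blast
    moreover have "a \<in> cell" using a by (simp add: rel_int_dim_def)
    ultimately show "a \<in> top_cell" using proj_not_interior by blast
  next
    assume a: "a \<in> top_cell"
    obtain W where W: "openin (Euclidean_space (length u - s)) W"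
      "top_cell = {a \<in> cell. proj a \<in> W}"
      "subtopology ?X top_cell homeomorphic_space subtopology (Euclidean_space (length u - s)) W"
      using top_cell_chart .
    have tX: "topspace (subtopology ?X cell) = cell" using cell_subset by auto
    have "openin (subtopology ?X cell) {a \<in> topspace (subtopology ?X cell). proj a \<in> W}"
      using cont W(1) by (rule openin_continuous_map_preimage)
    then have "openin (subtopology ?X cell) top_cell" by (simp only: tX W(2)[symmetric])
    moreover have "a \<in> cell" using a by blast
    ultimately show "a \<in> rel_int_dim ?X cell"
      unfolding rel_int_dim_def sa_dim_cell using a W(1,3) by blast
  }
qed

end

theorem mainTheorem7:
  fixes d s :: nat and f :: "real poly" and u :: "nat list"
  assumes "d \<ge> 1"
    and "degree f = d" and "lead_coeff f = 1" and "hyperbolic f"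
    and "s \<le> d"
    and "composition d u"
    and "\<exists>h \<in> Hsu d s f u. mult_comp h = u"
  shows "sa_dim (Euclidean_space (d - s)) (coords d s ` Hsu d s f u) = max (length u - s) 0
    \<and> rel_int_dim (Euclidean_space (d - s)) (coords d s ` Hsu d s f u)
        = coords d s ` {h \<in> Hsu d s f u. mult_comp h = u}"
proof -
  interpret stratum d s f u using assms(5-7) by unfold_locales
  \<comment> \<open>Subtraction on \<open>nat\<close> is truncated and so absorbs the maximum with
    0.\<close>
  show ?thesis using sa_dim_cell rel_int_dim_cell by simp
qed

end
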